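(* Let $G=(V,E)$ be a connected bipartite graph of order $n=r+s\ge 4$ with stable sets (bipartition classes) $U$ and $W$, $V=U\cup W$, where $|U|=r$, $|W|=s$ and $3\le r<s$. Then $\lambda(\overline{G})=\lambda(G)+1$ if and only if the following three conditions hold: (i) $W$ contains no pair of twins; (ii) there exists a vertex $w\in W$ such that $N(w)=U$; (iii) for every vertex $u\in U$, the edge-labeled graph $G^U$ has at least two edges with label $u$.
   Context: All graphs are simple and finite. $N(x)$ denotes the (open) neighborhood of $x$ in $G$. A set $S\subseteq V$ is distinguishing if $N(x)\cap S\neq N(y)\cap S$ for every pair of distinct vertices $x,y\in V\setminus S$; it is dominating if every vertex not in $S$ has a neighbor in $S$; a locating-dominating set (LD-set) is a set that is both distinguishing and dominating. $\lambda(G)$, the location-domination number, is the minimum cardinality of an LD-set of $G$. $\overline{G}$ is the complement of $G$. Two distinct vertices $x,y$ are twins if $N(x)=N(y)$ or $N(x)\cup\{x\}=N(y)\cup\{y\}$. For $S\subseteq V$, the $S$-associated graph $G^S$ is the edge-labeled graph with vertex set $V\setminus S$, where $x,y\in V\setminus S$ are adjacent iff the sets $N(x)\cap S$ and $N(y)\cap S$ differ in exactly one vertex $u\in S$ (i.e., their symmetric difference is $\{u\}$), and then the edge $xy$ receives label $\ell(xy)=u$. (In the paper $G^S$ is considered for distinguishing sets $S$; condition (i) is equivalent to $U$ being distinguishing.) *)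

theory Defs
  imports "Graph_Theory.Digraph_Component"
begin

text \<open>
  A finite simple graph is a \<^locale>\<open>pair_graph\<close>: a finite, loop-free, symmetric digraph whose
  arcs are pairs of vertices. An undirected edge is thus represented by its two arcs.
\<close>

definition nbhd :: "'a pair_pre_digraph \<Rightarrow> 'a \<Rightarrow> 'a set" where
  "nbhd G x = {y \<in> pverts G. (x, y) \<in> parcs G}"

definition graph_complement :: "'a pair_pre_digraph \<Rightarrow> 'a pair_pre_digraph" where
  "graph_complement G =
    \<lparr>pverts = pverts G,
     parcs = {(x, y). x \<in> pverts G \<and> y \<in> pverts G \<and> x \<noteq> y \<and> (x, y) \<notin> parcs G}\<rparr>"

definition stable_set :: "'a pair_pre_digraph \<Rightarrow> 'a set \<Rightarrow> bool" where
  "stable_set G S \<longleftrightarrow> S \<subseteq> pverts G \<and> (\<forall>x\<in>S. \<forall>y\<in>S. (x, y) \<notin> parcs G)"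

definition bipartition :: "'a pair_pre_digraph \<Rightarrow> 'a set \<Rightarrow> 'a set \<Rightarrow> bool" where
  "bipartition G U W \<longleftrightarrow>
    pverts G = U \<union> W \<and> U \<inter> W = {} \<and> stable_set G U \<and> stable_set G W"

definition twins :: "'a pair_pre_digraph \<Rightarrow> 'a \<Rightarrow> 'a \<Rightarrow> bool" where
  "twins G x y \<longleftrightarrow> x \<in> pverts G \<and> y \<in> pverts G \<and> x \<noteq> y \<and>
    (nbhd G x = nbhd G y \<or> nbhd G x \<union> {x} = nbhd G y \<union> {y})"

definition distinguishing :: "'a pair_pre_digraph \<Rightarrow> 'a set \<Rightarrow> bool" where
  "distinguishing G S \<longleftrightarrow> S \<subseteq> pverts G \<and>
    (\<forall>x \<in> pverts G - S. \<forall>y \<in> pverts G - S. x \<noteq> y \<longrightarrow> nbhd G x \<inter> S \<noteq> nbhd G y \<inter> S)"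

definition dominating :: "'a pair_pre_digraph \<Rightarrow> 'a set \<Rightarrow> bool" where
  "dominating G S \<longleftrightarrow> S \<subseteq> pverts G \<and> (\<forall>x \<in> pverts G - S. nbhd G x \<inter> S \<noteq> {})"

definition LD_set :: "'a pair_pre_digraph \<Rightarrow> 'a set \<Rightarrow> bool" where
  "LD_set G S \<longleftrightarrow> distinguishing G S \<and> dominating G S"

definition location_domination_number :: "'a pair_pre_digraph \<Rightarrow> nat" where
  "location_domination_number G = (LEAST k. \<exists>S. LD_set G S \<and> card S = k)"

definition nbhd_diff :: "'a pair_pre_digraph \<Rightarrow> 'a set \<Rightarrow> 'a \<Rightarrow> 'a \<Rightarrow> 'a set" where
  "nbhd_diff G S x y = sym_diff (nbhd G x \<inter> S) (nbhd G y \<inter> S)"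

definition associated_graph :: "'a pair_pre_digraph \<Rightarrow> 'a set \<Rightarrow> 'a pair_pre_digraph" where
  "associated_graph G S =
    \<lparr>pverts = pverts G - S,
     parcs = {(x, y). x \<in> pverts G - S \<and> y \<in> pverts G - S \<and> (\<exists>u\<in>S. nbhd_diff G S x y = {u})}\<rparr>"

text \<open>Meaningful only for adjacent vertices of the associated graph.\<close>

definition associated_label :: "'a pair_pre_digraph \<Rightarrow> 'a set \<Rightarrow> 'a \<Rightarrow> 'a \<Rightarrow> 'a" where
  "associated_label G S x y = (THE u. nbhd_diff G S x y = {u})"

text \<open>
  The edges are collected as unordered pairs, so that an edge is counted once and not once for each
  of its two arcs.
\<close>

definition edges_with_label :: "'a pair_pre_digraph \<Rightarrow> 'a set \<Rightarrow> 'a \<Rightarrow> 'a set set" where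
  "edges_with_label G S u =
    {{x, y} |x y. (x, y) \<in> parcs (associated_graph G S) \<and> associated_label G S x y = u}"

end

theory Submission
  imports Defs
begin

text \<open>
  A set is distinguishing in \<open>G\<close> iff it is in the complement, and it then fails to dominate the
  complement iff some outside vertex of \<open>G\<close> is adjacent to all of it. Hence
  \<open>\<lambda>(complement) \<le> \<lambda>(G) + 1\<close>, and in case of equality every minimum LD-set of \<open>G\<close> is
  contained in a neighbourhood, which in the bipartite case forces it to be \<open>U\<close> or \<open>W\<close>.
  Replacing a vertex \<open>u\<close> of that class by a neighbour of \<open>u\<close> gives an LD-set of the complement
  of the same size as soon as at most one pair of vertices is separated by \<open>u\<close> alone. Bondy's
  theorem excludes the larger class \<open>W\<close>, and for \<open>U\<close> one obtains (iii).

  Conversely, if every \<open>u \<in> U\<close> labels two edges, deleting a nonempty set \<open>K\<close> from the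
  neighbourhoods of the vertices of \<open>W\<close> identifies so many of them that at most \<open>|W| - |K| - 1\<close>
  traces remain: the first deleted vertex costs two traces, each further one at least one more.
  So a distinguishing set other than \<open>U\<close> has more than \<open>|U|\<close> elements.
\<close>

section \<open>Traces of a finite family of sets\<close>

text \<open>Deleting \<open>u\<close> as well applies \<open>X - {u}\<close> to the traces left by
  \<open>K\<close>. This map merges the traces of \<open>x\<close> and \<open>y\<close>, which are
  still distinct beforehand because \<open>u\<close> is not in \<open>K\<close>.\<close>

lemma card_trace_insert_less:
  assumes "finite W" "u \<notin> K" "x \<in> W" "y \<in> W" "sym_diff (N x) (N y) = {u}"
  shows "card ((\<lambda>w. N w - insert u K) ` W) < card ((\<lambda>w. N w - K) ` W)"
proof -
  let ?F = "(\<lambda>w. N w - K) ` W"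
  have "(\<lambda>w. N w - insert u K) ` W = (\<lambda>X. X - {u}) ` ?F"
    by (auto simp: image_image intro!: image_cong)
  moreover have "\<not> inj_on (\<lambda>X. X - {u}) ?F"
  proof
    assume inj: "inj_on (\<lambda>X. X - {u}) ?F"
    have "N x - K - {u} = N y - K - {u}" using assms(5) by blast
    then have "N x - K = N y - K" using inj assms(3,4) unfolding inj_on_def by blast
    then show False using assms(2,5) by blast
  qed
  ultimately show ?thesis
    using assms(1) by (metis card_image_le eq_card_imp_inj_on finite_imageI le_neq_implies_less)
qed

text \<open>By induction on \<open>K\<close>, each element merges at least two of the remaining
  traces. The set \<open>L\<close> stands for elements deleted earlier, so that a sharper count for
  them can be combined with this one.\<close>

lemma card_trace_union_le:
  assumes "finite W" "finite K" "K \<inter> L = {}"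
    and "\<And>u. u \<in> K \<Longrightarrow> \<exists>x\<in>W. \<exists>y\<in>W. sym_diff (N x) (N y) = {u}"
  shows "card ((\<lambda>w. N w - (K \<union> L)) ` W) + card K \<le> card ((\<lambda>w. N w - L) ` W)"
  using assms(2-)
proof (induction K rule: finite_induct)
  case empty
  then show ?case by simp
next
  case (insert u K)
  obtain x y where "x \<in> W" "y \<in> W" "sym_diff (N x) (N y) = {u}"
    using insert.prems(2)[of u] by auto
  moreover have "u \<notin> K \<union> L" using insert.hyps insert.prems by auto
  ultimately have "card ((\<lambda>w. N w - insert u (K \<union> L)) ` W) < card ((\<lambda>w. N w - (K \<union> L)) ` W)"
    by (intro card_trace_insert_less[OF assms(1)])
  moreover have "card ((\<lambda>w. N w - (K \<union> L)) ` W) + card K \<le> card ((\<lambda>w. N w - L) ` W)"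
    using insert.prems by (intro insert.IH) simp_all
  ultimately show ?case using insert.hyps by simp
qed

text \<open>Each pair consists of a set containing \<open>u\<close> and the same set without
  \<open>u\<close>. As \<open>N\<close> is injective, the larger set determines the pair, and its
  trace is already provided by the smaller one.\<close>

lemma card_trace_remove_le:
  assumes "finite W" "inj_on N W"
  shows "card ((\<lambda>w. N w - {u}) ` W)
    + card {{x, y} |x y. x \<in> W \<and> y \<in> W \<and> sym_diff (N x) (N y) = {u}} \<le> card W"
proof -
  let ?E = "{{x, y} |x y. x \<in> W \<and> y \<in> W \<and> sym_diff (N x) (N y) = {u}}"
  \<comment> \<open>\<open>M\<close> collects the indices of the larger sets: those whose partner
    without \<open>u\<close> also belongs to the family.\<close>
  define M where "M = {y \<in> W. u \<in> N y \<and> N y - {u} \<in> N ` W}"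
  have fin: "finite M" and sub: "M \<subseteq> W" using assms(1) by (auto simp: M_def)
  have "?E \<subseteq> (\<lambda>y. {inv_into W N (N y - {u}), y}) ` M"
  proof
    fix e assume "e \<in> ?E"
    then obtain x y where e: "e = {x, y}" and xy: "x \<in> W" "y \<in> W"
      and "sym_diff (N x) (N y) = {u}" by blast
    then have d: "v \<in> sym_diff (N x) (N y) \<longleftrightarrow> v = u" for v by simp
    \<comment> \<open>The pair is oriented so that \<open>y\<close> is the end whose set contains
      \<open>u\<close>.\<close>
    have "\<exists>x y. e = {x, y} \<and> x \<in> W \<and> y \<in> W \<and> u \<in> N y \<and> N x = N y - {u}"
    proof (cases "u \<in> N y")
      case True
      then have "v \<in> N x \<longleftrightarrow> v \<in> N y - {u}" for v using d[of v] by auto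
      then have "N x = N y - {u}" by (rule set_eqI)
      then show ?thesis using e xy True by (intro exI[of _ x] exI[of _ y]) simp
    next
      case False
      then have "v \<in> N y \<longleftrightarrow> v \<in> N x - {u}" for v using d[of v] by auto
      then have "N y = N x - {u}" by (rule set_eqI)
      moreover have "u \<in> N x" using d[of u] False by simp
      ultimately show ?thesis
        using e xy by (intro exI[of _ y] exI[of _ x]) (simp add: insert_commute)
    qed
    then obtain x y where *: "e = {x, y}" "x \<in> W" "y \<in> W" "u \<in> N y" "N x = N y - {u}" by blast
    then have "y \<in> M" unfolding M_def using imageI[of x W N] by simp
    moreover have "inv_into W N (N y - {u}) = x"
      using * assms(2) by (metis inv_into_f_f)
    ultimately show "e \<in> (\<lambda>y. {inv_into W N (N y - {u}), y}) ` M" using *(1) by blast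
  qed
  then have E: "card ?E \<le> card M"
    using fin by (meson card_image_le card_mono finite_imageI le_trans)
  have "(\<lambda>w. N w - {u}) ` W \<subseteq> (\<lambda>w. N w - {u}) ` (W - M)"
  proof
    fix X assume "X \<in> (\<lambda>w. N w - {u}) ` W"
    then obtain w where w: "w \<in> W" "X = N w - {u}" by blast
    show "X \<in> (\<lambda>w. N w - {u}) ` (W - M)"
    proof (cases "w \<in> M")
      case True
      then obtain x where "x \<in> W" "N x = N w - {u}" unfolding M_def by (auto simp: image_iff)
      moreover from this have "x \<notin> M" by (auto simp: M_def)
      ultimately show ?thesis using w by (intro image_eqI[of _ _ x]) auto
    next
      case False
      then show ?thesis using w by blast
    qed
  qed
  then have "card ((\<lambda>w. N w - {u}) ` W) \<le> card (W - M)"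
    using assms(1) by (meson card_image_le card_mono finite_Diff finite_imageI le_trans)
  also have "\<dots> = card W - card M" using fin sub by (rule card_Diff_subset)
  finally show ?thesis using E card_mono[OF assms(1) sub] by linarith
qed

text \<open>If every \<open>u\<close> were the sole difference of some pair, deleting all of
  \<open>U\<close> would cost \<open>card U\<close> of at most \<open>card W\<close> traces, yet at
  least one trace survives.\<close>

lemma bondy:
  assumes "finite W" "W \<noteq> {}" "finite U" "card W \<le> card U"
  shows "\<exists>u\<in>U. \<forall>x\<in>W. \<forall>y\<in>W. sym_diff (N x) (N y) \<noteq> {u}"
proof (rule ccontr)
  assume "\<not> ?thesis"
  then have "\<And>u. u \<in> U \<Longrightarrow> \<exists>x\<in>W. \<exists>y\<in>W. sym_diff (N x) (N y) = {u}" by blast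
  then have "card ((\<lambda>w. N w - (U \<union> {})) ` W) + card U \<le> card ((\<lambda>w. N w - {}) ` W)"
    using assms by (intro card_trace_union_le) auto
  moreover have "card ((\<lambda>w. N w - {}) ` W) \<le> card W" using assms(1) by (rule card_image_le)
  moreover have "card ((\<lambda>w. N w - (U \<union> {})) ` W) > 0" using assms by (simp add: card_gt_0_iff)
  ultimately show False using assms(4) by linarith
qed

section \<open>Locating-dominating sets of a graph and of its complement\<close>

lemma nbhd_graph_complement_Int:
  assumes "S \<subseteq> pverts G" "x \<in> pverts G - S"
  shows "nbhd (graph_complement G) x \<inter> S = S - nbhd G x"
  using assms by (auto simp: nbhd_def graph_complement_def)

text \<open>For vertices outside \<open>S\<close>, the complement graph replaces each trace by its
  complement in \<open>S\<close>, a bijection on subsets of \<open>S\<close>.\<close>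

lemma distinguishing_graph_complement:
  "distinguishing (graph_complement G) S \<longleftrightarrow> distinguishing G S"
proof (cases "S \<subseteq> pverts G")
  case True
  have "S - nbhd G x = S - nbhd G y \<longleftrightarrow> nbhd G x \<inter> S = nbhd G y \<inter> S" for x y
    by blast
  then show ?thesis
    using True nbhd_graph_complement_Int[OF True]
    by (simp add: distinguishing_def) (simp add: graph_complement_def)
next
  case False
  then show ?thesis by (simp add: distinguishing_def graph_complement_def)
qed

lemma LD_set_graph_complement_iff:
  "LD_set (graph_complement G) S \<longleftrightarrow>
    distinguishing G S \<and> (\<forall>x\<in>pverts G - S. \<not> S \<subseteq> nbhd G x)"
proof -
  have "dominating (graph_complement G) S \<longleftrightarrow> (\<forall>x\<in>pverts G - S. \<not> S \<subseteq> nbhd G x)"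
    if S: "S \<subseteq> pverts G"
  proof -
    have "pverts (graph_complement G) = pverts G" by (simp add: graph_complement_def)
    then show ?thesis using S nbhd_graph_complement_Int[OF S]
      unfolding dominating_def by auto
  qed
  then show ?thesis
    unfolding LD_set_def distinguishing_graph_complement
    by (auto simp: distinguishing_def)
qed

lemma location_domination_number_le:
  "LD_set G S \<Longrightarrow> location_domination_number G \<le> card S"
  unfolding location_domination_number_def by (rule Least_le) blast

lemma LD_set_pverts: "LD_set G (pverts G)"
  by (simp add: LD_set_def distinguishing_def dominating_def)

lemma location_domination_number_attained:
  "\<exists>S. LD_set G S \<and> card S = location_domination_number G"
  unfolding location_domination_number_def
  by (rule LeastI_ex) (use LD_set_pverts in blast)

lemma distinguishing_mono:
  assumes "distinguishing G S" "S \<subseteq> T" "T \<subseteq> pverts G"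
  shows "distinguishing G T"
  unfolding distinguishing_def
proof (intro conjI ballI impI assms(3) notI)
  fix x y assume "x \<in> pverts G - T" "y \<in> pverts G - T" "x \<noteq> y" "nbhd G x \<inter> T = nbhd G y \<inter> T"
  moreover from this have "nbhd G x \<inter> S = nbhd G y \<inter> S" using assms(2) by blast
  ultimately show False using assms(1,2) unfolding distinguishing_def by blast
qed

text \<open>In a minimum LD-set \<open>S\<close> of \<open>G\<close>, at most one outside vertex is
  adjacent to all of \<open>S\<close>, since two would share a trace. Adding that vertex gives an
  LD-set of the complement.\<close>

lemma location_domination_number_complement_le:
  assumes "finite (pverts G)"
  shows "location_domination_number (graph_complement G) \<le> location_domination_number G + 1"
proof -
  obtain S where S: "LD_set G S" "card S = location_domination_number G"
    using location_domination_number_attained by blast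
  have dis: "distinguishing G S" and sub: "S \<subseteq> pverts G"
    using S(1) by (auto simp: LD_set_def distinguishing_def)
  show ?thesis
  proof (cases "\<exists>x\<in>pverts G - S. S \<subseteq> nbhd G x")
    case False
    then have "LD_set (graph_complement G) S" using dis by (simp add: LD_set_graph_complement_iff)
    then show ?thesis using location_domination_number_le S(2) by fastforce
  next
    case True
    then obtain x where x: "x \<in> pverts G - S" "S \<subseteq> nbhd G x" by blast
    have "distinguishing G (insert x S)" using dis sub x by (intro distinguishing_mono[OF dis]) auto
    moreover have "\<not> insert x S \<subseteq> nbhd G y" if y: "y \<in> pverts G - insert x S" for y
    proof
      assume "insert x S \<subseteq> nbhd G y"
      then have "nbhd G y \<inter> S = nbhd G x \<inter> S" using x by blast
      then show False using dis x y unfolding distinguishing_def by blast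
    qed
    ultimately have "LD_set (graph_complement G) (insert x S)"
      by (simp add: LD_set_graph_complement_iff)
    then have "location_domination_number (graph_complement G) \<le> card (insert x S)"
      by (rule location_domination_number_le)
    also have "\<dots> = card S + 1" using x finite_subset[OF sub assms] by simp
    finally show ?thesis using S(2) by simp
  qed
qed

lemma minimum_LD_set_subset_nbhd:
  assumes "location_domination_number (graph_complement G) = location_domination_number G + 1"
    and "LD_set G S" "card S = location_domination_number G"
  shows "\<exists>x\<in>pverts G - S. S \<subseteq> nbhd G x"
proof (rule ccontr)
  assume "\<not> ?thesis"
  then have "LD_set (graph_complement G) S"
    using assms(2) unfolding LD_set_graph_complement_iff by (simp add: LD_set_def)
  then show False using location_domination_number_le assms(1,3) by fastforce
qed

section \<open>Bipartite graphs\<close>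

lemma bipartition_sym: "bipartition G U W \<Longrightarrow> bipartition G W U"
  by (auto simp: bipartition_def)

lemma nbhd_sym: "pair_graph G \<Longrightarrow> y \<in> nbhd G x \<longleftrightarrow> x \<in> nbhd G y"
proof -
  assume "pair_graph G"
  then interpret pair_graph G .
  show ?thesis
    unfolding nbhd_def using arcs_symmetric[of x y] arcs_symmetric[of y x]
    by (auto dest: in_arcsD1 in_arcsD2)
qed

lemma bipartition_nbhd_subset:
  assumes "bipartition G U W" "w \<in> W"
  shows "nbhd G w \<subseteq> U"
  using assms by (auto simp: bipartition_def stable_set_def nbhd_def)

lemma bipartition_finite:
  assumes "pair_graph G" "bipartition G U W"
  shows "finite U" "finite W"
proof -
  interpret pair_graph G by fact
  have "finite (U \<union> W)" using assms(2) finite_verts by (simp add: bipartition_def)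
  then show "finite U" "finite W" by auto
qed

lemma connected_nbhd_nonempty:
  assumes "pair_graph G" "Digraph_Component.connected (with_proj G)"
    and "x \<in> pverts G" "y \<in> pverts G" "x \<noteq> y"
  shows "nbhd G x \<noteq> {}"
proof -
  interpret pair_graph G by fact
  \<comment> \<open>Connectedness refers to reachability in the symmetric closure, which for a
    symmetric digraph is ordinary reachability. A path to \<open>y\<close> then begins with an arc
    at \<open>x\<close>.\<close>
  have "symmetric (with_proj G)" by (rule sym_arcs)
  then have "x \<rightarrow>\<^sup>*\<^bsub>with_proj G\<^esub> y"
    using assms by (auto simp: connected_def strongly_connected_def reachable_mk_symmetric_eq)
  then have "\<exists>z. (x, z) \<in> parcs G"
  proof (cases rule: converse_reachable_cases)
    case base
    then show ?thesis using assms(5) by simp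
  next
    case (step z)
    then show ?thesis by (auto simp: arcs_ends_conv)
  qed
  then show ?thesis by (auto simp: nbhd_def dest: in_arcsD2)
qed

text \<open>Here \<open>S\<close> lies in \<open>U\<close>, so a vertex of \<open>U\<close> outside
  \<open>S\<close>, having neighbours only in \<open>W\<close>, would not be dominated.\<close>

lemma LD_set_subset_nbhd_eq:
  assumes bip: "bipartition G U W" and S: "LD_set G S" and x: "x \<in> W" "S \<subseteq> nbhd G x"
  shows "S = U" "nbhd G x = U"
proof -
  have SU: "S \<subseteq> U" and xU: "nbhd G x \<subseteq> U" using bipartition_nbhd_subset[OF bip x(1)] x(2) by auto
  have "U \<subseteq> S"
  proof (rule ccontr)
    assume "\<not> U \<subseteq> S"
    then obtain u where u: "u \<in> U" "u \<notin> S" by blast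
    then have "nbhd G u \<inter> S \<noteq> {}"
      using S bip by (auto simp: LD_set_def dominating_def bipartition_def)
    then show False
      using bipartition_nbhd_subset[OF bipartition_sym[OF bip] u(1)] SU bip
      by (auto simp: bipartition_def)
  qed
  then show "S = U" "nbhd G x = U" using SU xU x(2) by auto
qed

section \<open>Conditions (i) and (iii) as statements about the family of neighbourhoods\<close>

lemma distinguishing_part_iff:
  assumes "bipartition G U W"
  shows "distinguishing G U \<longleftrightarrow> inj_on (nbhd G) W"
proof -
  have "pverts G - U = W" "U \<subseteq> pverts G" using assms by (auto simp: bipartition_def)
  moreover have "nbhd G w \<inter> U = nbhd G w" if "w \<in> W" for w
    using bipartition_nbhd_subset[OF assms that] by blast
  ultimately show ?thesis by (auto simp: distinguishing_def inj_on_def)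
qed

text \<open>Closed neighbourhoods of distinct vertices of the stable set \<open>W\<close> never
  coincide, so only equal open neighbourhoods can produce twins.\<close>

lemma no_twins_iff_inj_on:
  assumes "bipartition G U W"
  shows "\<not> (\<exists>x\<in>W. \<exists>y\<in>W. twins G x y) \<longleftrightarrow> inj_on (nbhd G) W"
proof -
  have "nbhd G x \<union> {x} \<noteq> nbhd G y \<union> {y}" if "x \<in> W" "y \<in> W" "x \<noteq> y" for x y
    using that bipartition_nbhd_subset[OF assms] assms unfolding bipartition_def by blast
  moreover have "W \<subseteq> pverts G" using assms by (auto simp: bipartition_def)
  ultimately show ?thesis unfolding twins_def inj_on_def by blast
qed

lemma edges_with_label_part:
  assumes "bipartition G U W" "u \<in> U"
  shows "edges_with_label G U u =
    {{x, y} |x y. x \<in> W \<and> y \<in> W \<and> sym_diff (nbhd G x) (nbhd G y) = {u}}"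
proof -
  have V: "pverts G - U = W" using assms by (auto simp: bipartition_def)
  have nd: "nbhd_diff G U x y = sym_diff (nbhd G x) (nbhd G y)" if "x \<in> W" "y \<in> W" for x y
  proof -
    have "nbhd G x \<inter> U = nbhd G x" "nbhd G y \<inter> U = nbhd G y"
      using bipartition_nbhd_subset[OF assms(1)] that by blast+
    then show ?thesis by (simp add: nbhd_diff_def)
  qed
  have "(x, y) \<in> parcs (associated_graph G U) \<and> associated_label G U x y = u \<longleftrightarrow>
      x \<in> W \<and> y \<in> W \<and> sym_diff (nbhd G x) (nbhd G y) = {u}" (is "?L \<longleftrightarrow> ?R") for x y
  proof
    assume ?L
    then obtain v where v: "x \<in> W" "y \<in> W" "nbhd_diff G U x y = {v}"
      by (auto simp: associated_graph_def V)
    then have "associated_label G U x y = v" by (simp add: associated_label_def)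
    with \<open>?L\<close> v nd show ?R by simp
  next
    assume ?R
    then show ?L using assms(2) nd
      by (simp add: associated_graph_def associated_label_def V)
  qed
  then show ?thesis unfolding edges_with_label_def by simp
qed

section \<open>Exchanging a vertex of one class for a neighbour\<close>

text \<open>Among the outside vertices only \<open>u\<close> sees \<open>y\<close>, so
  \<open>u\<close> is separated from \<open>W - {y}\<close>, where the traces are the neighbourhoods
  without \<open>u\<close>. No outside vertex sees the whole set: those in \<open>W\<close> miss
  \<open>y\<close>, and \<open>u\<close> misses the rest of \<open>U\<close>.\<close>

lemma LD_set_complement_exchange:
  assumes G: "pair_graph G" and bip: "bipartition G U W" and card: "2 \<le> card U"
    and u: "u \<in> U" and y: "y \<in> W" "u \<in> nbhd G y"
    and inj: "inj_on (\<lambda>w. nbhd G w - {u}) (W - {y})"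
  shows "LD_set (graph_complement G) (insert y (U - {u}))"
  unfolding LD_set_graph_complement_iff
proof
  let ?S = "insert y (U - {u})"
  have disj: "U \<inter> W = {}" and V: "pverts G = U \<union> W" using bip by (auto simp: bipartition_def)
  have VS: "pverts G - ?S = insert u (W - {y})" using u y disj V by blast
  have yu: "y \<in> nbhd G u" using y(2) nbhd_sym[OF G] by blast
  have NW: "nbhd G w \<subseteq> U" if "w \<in> W" for w using bipartition_nbhd_subset[OF bip that] .
  have NU: "nbhd G v \<subseteq> W" if "v \<in> U" for v
    using bipartition_nbhd_subset[OF bipartition_sym[OF bip] that] .
  have W: "nbhd G w \<inter> ?S = nbhd G w - {u}" if "w \<in> W" for w
    using NW[OF that] y disj by blast
  have uW: "nbhd G u \<inter> ?S \<noteq> nbhd G w \<inter> ?S" if "w \<in> W" for w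
    using NW[OF that] yu y disj by blast
  show "distinguishing G ?S"
    unfolding distinguishing_def VS
  proof (intro conjI ballI impI)
    show "?S \<subseteq> pverts G" using V y by blast
    fix a b assume ab: "a \<in> insert u (W - {y})" "b \<in> insert u (W - {y})" "a \<noteq> b"
    show "nbhd G a \<inter> ?S \<noteq> nbhd G b \<inter> ?S"
    proof (cases "a = u \<or> b = u")
      case True
      then show ?thesis using ab uW by (metis DiffD1 insertE)
    next
      case False
      then have "a \<in> W - {y}" "b \<in> W - {y}" using ab by auto
      then show ?thesis using inj ab(3) W by (auto simp: inj_on_def)
    qed
  qed
  \<comment> \<open>A second vertex \<open>v\<close> of \<open>U\<close> stays in the set and is not
    adjacent to \<open>u\<close>.\<close>
  have "card (U - {u}) > 0" using card u by (simp add: card_Diff_singleton)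
  then obtain v where v: "v \<in> U" "v \<noteq> u" by (metis card_gt_0_iff DiffE ex_in_conv singletonI)
  show "\<forall>x\<in>pverts G - ?S. \<not> ?S \<subseteq> nbhd G x"
    unfolding VS using NW NU[OF u] v y disj by blast
qed

lemma minimum_part_exchange:
  assumes "pair_graph G" "bipartition G U W" "2 \<le> card U"
    and "location_domination_number (graph_complement G) = location_domination_number G + 1"
    and "location_domination_number G = card U"
    and "u \<in> U" "y \<in> W" "u \<in> nbhd G y"
  shows "\<not> inj_on (\<lambda>w. nbhd G w - {u}) (W - {y})"
proof
  assume "inj_on (\<lambda>w. nbhd G w - {u}) (W - {y})"
  then have "LD_set (graph_complement G) (insert y (U - {u}))"
    using LD_set_complement_exchange assms by metis
  then have "location_domination_number (graph_complement G) \<le> card (insert y (U - {u}))"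
    by (rule location_domination_number_le)
  also have "\<dots> = card U"
  proof -
    have "y \<notin> U - {u}" "finite U"
      using assms(2,7) bipartition_finite[OF assms(1,2)] by (auto simp: bipartition_def)
    then show ?thesis using assms(3,6) by (simp add: card_Diff_singleton)
  qed
  finally show False using assms(4,5) by simp
qed

lemma trace_eq_imp_sym_diff:
  assumes "inj_on N W" "x \<in> W" "y \<in> W" "x \<noteq> y" "N x - {u} = N y - {u}"
  shows "sym_diff (N x) (N y) = {u}"
proof -
  have "N x \<noteq> N y" using assms by (auto simp: inj_on_def)
  then show ?thesis using assms(5) by blast
qed

text \<open>Bondy's theorem for the neighbourhoods of \<open>U\<close>, with ground set
  \<open>W\<close>, yields a \<open>w\<close> whose deletion merges no two of them. Exchanging
  \<open>w\<close> for \<open>u\<close> then gives an LD-set of the complement that is too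
  small.\<close>

lemma minimum_larger_part_impossible:
  assumes G: "pair_graph G" and bip: "bipartition G U W" and card: "2 \<le> card W" "card U \<le> card W"
    and eq: "location_domination_number (graph_complement G) = location_domination_number G + 1"
    and min: "location_domination_number G = card W" and dis: "distinguishing G W"
    and u: "u \<in> U" "nbhd G u = W"
  shows False
proof -
  note bip' = bipartition_sym[OF bip]
  have inj: "inj_on (nbhd G) U" using dis distinguishing_part_iff[OF bip'] by simp
  obtain w where w: "w \<in> W" "\<forall>x\<in>U. \<forall>y\<in>U. sym_diff (nbhd G x) (nbhd G y) \<noteq> {w}"
    using bondy[of U W "nbhd G"] bipartition_finite[OF G bip] u card by blast
  have "inj_on (\<lambda>v. nbhd G v - {w}) (U - {u})"
    using w trace_eq_imp_sym_diff[OF inj] unfolding inj_on_def by blast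
  then show False
    using minimum_part_exchange[OF G bip' card(1) eq min w(1) u(1)] u w by simp
qed

text \<open>The exchange fails for every neighbour \<open>y\<close> of \<open>u\<close>, so some
  edge with label \<open>u\<close> avoids \<open>y\<close>. Two suitable choices of \<open>y\<close>
  give two different edges.\<close>

lemma two_edges_of_minimum_part:
  assumes G: "pair_graph G" and bip: "bipartition G U W" and card: "2 \<le> card U"
    and eq: "location_domination_number (graph_complement G) = location_domination_number G + 1"
    and min: "location_domination_number G = card U" and inj: "inj_on (nbhd G) W"
    and w: "w \<in> W" "nbhd G w = U" and u: "u \<in> U"
  shows "2 \<le> card (edges_with_label G U u)"
proof -
  let ?E = "edges_with_label G U u"
  note E = edges_with_label_part[OF bip u]
  note exch = minimum_part_exchange[OF G bip card eq min u]
  have pair: "\<exists>a\<in>W - {y}. \<exists>b\<in>W - {y}. u \<in> nbhd G b \<and> sym_diff (nbhd G a) (nbhd G b) = {u}"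
    if y: "y \<in> W" "u \<in> nbhd G y" for y
  proof -
    obtain a b where ab: "a \<in> W - {y}" "b \<in> W - {y}" "a \<noteq> b" "nbhd G a - {u} = nbhd G b - {u}"
      using exch[OF y] unfolding inj_on_def by blast
    then have d: "sym_diff (nbhd G a) (nbhd G b) = {u}"
      using trace_eq_imp_sym_diff[OF inj] by blast
    then have "u \<in> nbhd G b \<or> u \<in> nbhd G a" by blast
    moreover have "sym_diff (nbhd G b) (nbhd G a) = {u}" using d by blast
    ultimately show ?thesis using ab d by blast
  qed
  \<comment> \<open>The first choice is \<open>w\<close>, which is adjacent to every
    \<open>u\<close> in \<open>U\<close>.\<close>
  obtain x y where xy: "x \<in> W" "y \<in> W" "u \<in> nbhd G y" "sym_diff (nbhd G x) (nbhd G y) = {u}"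
    using pair[of w] w u by blast
  \<comment> \<open>The second choice is the end \<open>y\<close> of the first edge that is adjacent
    to \<open>u\<close>; the new edge avoids it and is therefore different.\<close>
  obtain a b where ab: "a \<in> W - {y}" "b \<in> W - {y}" "sym_diff (nbhd G a) (nbhd G b) = {u}"
    using pair[of y] xy by blast
  have "{{x, y}, {a, b}} \<subseteq> ?E" unfolding E using xy ab by blast
  moreover have "finite ?E"
    unfolding E by (rule finite_subset[of _ "Pow W"]) (auto simp: bipartition_finite[OF G bip])
  moreover have "{x, y} \<noteq> {a, b}" using ab by (metis DiffE insertCI insertE empty_iff)
  ultimately show ?thesis by (metis card_2_iff card_mono)
qed

section \<open>Lower bound from two edges per label\<close>

text \<open>With \<open>K = U - S\<close>, the vertices of \<open>W - S\<close> have distinct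
  neighbourhoods outside \<open>K\<close>, and at most \<open>card W - card K - 1\<close> of these
  exist. Hence \<open>S\<close> has at least \<open>card K + 1\<close> vertices in \<open>W\<close>,
  more than it lacks in \<open>U\<close>.\<close>

lemma card_distinguishing_gt:
  assumes G: "pair_graph G" and bip: "bipartition G U W" and inj: "inj_on (nbhd G) W"
    and edges: "\<And>u. u \<in> U \<Longrightarrow> 2 \<le> card (edges_with_label G U u)"
    and S: "distinguishing G S" and nsub: "\<not> U \<subseteq> S"
  shows "card U < card S"
proof -
  note fin = bipartition_finite[OF G bip]
  have disj: "U \<inter> W = {}" and V: "pverts G = U \<union> W" using bip by (auto simp: bipartition_def)
  have SV: "S \<subseteq> U \<union> W" using S V by (auto simp: distinguishing_def)
  define K where "K = U - S"
  obtain u where u: "u \<in> U" "u \<notin> S" using nsub by blast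
  \<comment> \<open>One vertex \<open>u\<close> is set apart and deleted first: its two edges cost
    two traces, while each vertex of \<open>L\<close> costs at least one. The extra trace makes the
    final inequality strict.\<close>
  define L where "L = K - {u}"
  have KL: "K = L \<union> {u}" "u \<notin> L" using u by (auto simp: K_def L_def)
  have finL: "finite L" using fin by (simp add: L_def K_def)
  have lab: "\<exists>x\<in>W. \<exists>y\<in>W. sym_diff (nbhd G x) (nbhd G y) = {v}" if "v \<in> U" for v
  proof -
    have "edges_with_label G U v \<noteq> {}" using edges[OF that] by auto
    then show ?thesis unfolding edges_with_label_part[OF bip that] by blast
  qed
  have "card ((\<lambda>w. nbhd G w - (L \<union> {u})) ` W) + card L \<le> card ((\<lambda>w. nbhd G w - {u}) ` W)"
    using fin finL KL lab by (intro card_trace_union_le) (auto simp: L_def K_def)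
  moreover have "card ((\<lambda>w. nbhd G w - {u}) ` W) + card (edges_with_label G U u) \<le> card W"
    unfolding edges_with_label_part[OF bip u(1)] by (rule card_trace_remove_le[OF fin(2) inj])
  moreover have "card K = card L + 1" using KL finL by simp
  ultimately have few: "card ((\<lambda>w. nbhd G w - K) ` W) + card K + 1 \<le> card W"
    using edges[OF u(1)] KL(1) by simp
  have "inj_on (\<lambda>w. nbhd G w - K) (W - S)"
  proof (rule inj_onI, rule ccontr)
    fix x y assume xy: "x \<in> W - S" "y \<in> W - S" "nbhd G x - K = nbhd G y - K" "x \<noteq> y"
    have "nbhd G w \<inter> S = nbhd G w - K" if "w \<in> W" for w
      using bipartition_nbhd_subset[OF bip that] by (auto simp: K_def)
    then show False using S xy V unfolding distinguishing_def by blast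
  qed
  then have "card (W - S) = card ((\<lambda>w. nbhd G w - K) ` (W - S))" by (simp add: card_image)
  also have "\<dots> \<le> card ((\<lambda>w. nbhd G w - K) ` W)" using fin by (intro card_mono) auto
  finally have "card (W - S) + card K + 1 \<le> card W" using few by simp
  moreover have "card W = card (W - S) + card (W \<inter> S)"
    using fin by (metis card_Int_Diff add.commute)
  moreover have "card U = card K + card (U \<inter> S)"
    unfolding K_def using fin by (metis card_Int_Diff add.commute)
  moreover have "card S = card (U \<inter> S) + card (W \<inter> S)"
  proof -
    have "S = (U \<inter> S) \<union> (W \<inter> S)" using SV by blast
    then show ?thesis using fin disj by (metis card_Un_disjoint finite_Int Int_assoc
        inf_left_commute inf_bot_right inf_commute)
  qed
  ultimately show ?thesis by linarith
qed

theorem theorem17: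
  fixes G :: "'a pair_pre_digraph" and U W :: "'a set" and n r s :: nat
  assumes "pair_graph G"
    and "Digraph_Component.connected (with_proj G)"
    and "bipartition G U W"
    and "card (pverts G) = n" and "n = r + s" and "n \<ge> 4"
    and "card U = r" and "card W = s"
    and "3 \<le> r" and "r < s"
  shows "location_domination_number (graph_complement G) = location_domination_number G + 1 \<longleftrightarrow>
    (\<not> (\<exists>x\<in>W. \<exists>y\<in>W. twins G x y)) \<and>
    (\<exists>w\<in>W. nbhd G w = U) \<and>
    (\<forall>u\<in>U. card (edges_with_label G U u) \<ge> 2)"
    (is "?eq \<longleftrightarrow> _")
proof -
  note G = assms(1) and bip = assms(3)
  note bip' = bipartition_sym[OF bip]
  note fin = bipartition_finite[OF G bip]
  have disj: "U \<inter> W = {}" and V: "pverts G = U \<union> W" using bip by (auto simp: bipartition_def)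
  have r: "2 \<le> card U" "2 \<le> card W" "card U \<le> card W" using assms by auto
  have "?eq \<longleftrightarrow> inj_on (nbhd G) W \<and> (\<exists>w\<in>W. nbhd G w = U) \<and>
    (\<forall>u\<in>U. card (edges_with_label G U u) \<ge> 2)"
  proof (intro iffI)
    assume eq: ?eq
    obtain S where S: "LD_set G S" "card S = location_domination_number G"
      using location_domination_number_attained by blast
    have dis: "distinguishing G S" using S by (simp add: LD_set_def)
    obtain x where x: "x \<in> pverts G - S" "S \<subseteq> nbhd G x"
      using minimum_LD_set_subset_nbhd[OF eq S] by blast
    \<comment> \<open>If \<open>x\<close> were in \<open>U\<close>, the minimum set \<open>S\<close>
      would be the larger class \<open>W\<close>.\<close>
    have "x \<notin> U"
    proof
      assume xU: "x \<in> U"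
      note SW = LD_set_subset_nbhd_eq[OF bip' S(1) xU x(2)]
      show False
        using minimum_larger_part_impossible[OF G bip r(2,3) eq _ _ xU] S dis SW by simp
    qed
    then have xW: "x \<in> W" using x V by blast
    note SU = LD_set_subset_nbhd_eq[OF bip S(1) xW x(2)]
    have inj: "inj_on (nbhd G) W" using dis SU distinguishing_part_iff[OF bip] by simp
    then show "inj_on (nbhd G) W \<and> (\<exists>w\<in>W. nbhd G w = U) \<and>
        (\<forall>u\<in>U. card (edges_with_label G U u) \<ge> 2)"
      using two_edges_of_minimum_part[OF G bip r(1) eq _ inj xW SU(2)] S(2) SU xW by auto
  next
    assume "inj_on (nbhd G) W \<and> (\<exists>w\<in>W. nbhd G w = U) \<and>
      (\<forall>u\<in>U. card (edges_with_label G U u) \<ge> 2)"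
    then obtain w where inj: "inj_on (nbhd G) W" and w: "w \<in> W" "nbhd G w = U"
      and edges: "\<And>u. u \<in> U \<Longrightarrow> 2 \<le> card (edges_with_label G U u)" by blast
    \<comment> \<open>Connectedness gives every vertex of \<open>W\<close> a neighbour, which must
      lie in \<open>U\<close>.\<close>
    have "dominating G U"
      unfolding dominating_def
    proof (intro conjI ballI)
      show "U \<subseteq> pverts G" using V by blast
      fix x assume "x \<in> pverts G - U"
      then have xW: "x \<in> W" using V by blast
      obtain u where "u \<in> U" using r(1) by fastforce
      then have "nbhd G x \<noteq> {}"
        using connected_nbhd_nonempty[OF G assms(2), of x u] xW V disj by blast
      then show "nbhd G x \<inter> U \<noteq> {}" using bipartition_nbhd_subset[OF bip xW] by blast
    qed
    then have "LD_set G U" using inj distinguishing_part_iff[OF bip] by (simp add: LD_set_def)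
    then have upper: "location_domination_number G \<le> card U" by (rule location_domination_number_le)
    obtain S where S: "LD_set (graph_complement G) S"
      "card S = location_domination_number (graph_complement G)"
      using location_domination_number_attained by blast
    then have dis: "distinguishing G S" and nd: "\<forall>x\<in>pverts G - S. \<not> S \<subseteq> nbhd G x"
      by (simp_all add: LD_set_graph_complement_iff)
    have "card U < card S"
    proof (cases "U \<subseteq> S")
      case True
      \<comment> \<open>In the complement, \<open>U\<close> fails to dominate \<open>w\<close> by
        (ii), so \<open>S\<close> contains \<open>U\<close> properly.\<close>
      have "S \<noteq> U" using nd w V disj by blast
      moreover have "finite S" using dis V fin finite_subset by (auto simp: distinguishing_def)
      ultimately show ?thesis using True by (simp add: psubset_card_mono psubset_eq)
    next
      case False
      then show ?thesis using card_distinguishing_gt[OF G bip inj edges dis] by blast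
    qed
    moreover have "location_domination_number (graph_complement G) \<le> location_domination_number G + 1"
      using V fin by (intro location_domination_number_complement_le) simp
    ultimately show ?eq using upper S(2) by linarith
  qed
  then show ?thesis using no_twins_iff_inj_on[OF bip] by simp
qed

end
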